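(* Let $1\le p\le\infty$ and let $A,B:L_p(\mathbb{R},\mu)\to L_p(\mathbb{R},\mu)$ be the operators defined, for almost every $t$, by $$(Ax)(t)=\int_{\alpha_1}^{\beta_1}I_{[\alpha,\beta]}(t)\,\theta_{A,1}\sin(\omega t)\cos(\omega s)x(s)\,d\mu_s,$$ $$(Bx)(t)=\int_{\alpha_1}^{\beta_1}I_{[\alpha,\beta]}(t)\big(\theta_{B,1}\sin(\omega t)\cos(\omega s)+\theta_{B,3}\sin(\omega t)\sin(\omega s)\big)x(s)\,d\mu_s,$$ where $\theta_{A,1},\theta_{B,1},\theta_{B,3},\omega\in\mathbb{R}$, $\delta\in\mathbb{R}\setminus\{0\}$, $\alpha,\beta,\alpha_1,\beta_1\in\mathbb{R}$, $\alpha_1<\beta_1$, $\alpha\le\alpha_1$, $\beta\ge\beta_1$, either $\frac{\omega}{\pi}(\beta_1-\alpha_1)\in\mathbb{Z}$ or $\frac{\omega}{\pi}(\beta_1+\alpha_1)\in\mathbb{Z}$, and $\sigma_1\ne0$, $\sigma_2\neq0$. Let $\{\theta_n\}$ and $\{\varsigma_n\}$ be sequences of real numbers and let $A_n,B_n:L_p(\mathbb{R},\mu)\to L_p(\mathbb{R},\mu)$ be defined, for almost every $t$, by $$(A_nx)(t)=\int_{\alpha_1}^{\beta_1}I_{[\alpha,\beta]}(t)\,\theta_n\sin(\omega t)\cos(\omega s)x(s)\,d\mu_s,$$ $$(B_nx)(t)=\int_{\alpha_1}^{\beta_1}I_{[\alpha,\beta]}(t)\big(\theta_{B,1}\sin(\omega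 t)\cos(\omega s)+\varsigma_n\sin(\omega t)\sin(\omega s)\big)x(s)\,d\mu_s.$$ Then: 1. $AB=\delta BA^2=0$, $A_nB=\delta BA_n^2=0$, $AB_n=\delta B_nA^2=0$ and $A_nB_n=\delta B_nA_n^2=0$ for each positive integer $n$. Moreover, for all $x\in L_p(\mathbb{R},\mu)$ and almost every $t$, $$(AB-BA)x(t)=-(BAx)(t)=-\sigma_1\theta_{A,1}\theta_{B,3}\int_{\alpha_1}^{\beta_1}I_{[\alpha,\beta]}(t)\sin(\omega t)\cos(\omega s)x(s)\,d\mu_s.$$ 2. If $\theta_n\to0$ as $n\to\infty$, then $A_n\to0$ in norm and so $A_nB-BA_n\to0$ in norm. 3. If $\varsigma_n\to0$ as $n\to\infty$, then $B_n\to\tilde B$ in norm, where $(\tilde Bx)(t)=\int_{\alpha_1}^{\beta_1}I_{[\alpha,\beta]}(t)\theta_{B,1}\sin(\omega t)\cos(\omega s)x(s)\,d\mu_s$ for almost every $t$. Moreover, $AB_n-B_nA\to0$ in norm and $\tilde B$ commutes with $A$. 4. If $\theta_n\to0$ and $\varsigma_n\to0$ as $n\to\infty$, then $A_nB_n-B_nA_n\to0$ in norm. 5. Let $\lambda_0\in\mathrm{cl}(\Lambda)$. If $\theta_{B,3}\theta_{A,1}\sigma_1\tilde\lambda\to0$ when $(\theta_{A,1},\theta_{B,1},\theta_{B,3},\alpha_1,\beta_1,\alpha,\beta,\sigma_1,\sigma_2,\delta,\omega)\to\lambda_0$ within $\Lambda$, then for all $x\in L_p(\mathbb{R},\mu)$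 it holds that $\|(AB-BA)x\|_{L_p}\to0$ (along the same limit of parameters, $A$ and $B$ being the operators with these parameters).
   Context: $\mu$ is Lebesgue measure on $\mathbb{R}$; $L_p(\mathbb{R},\mu)$ is the real Lebesgue space; the index in $d\mu_s$ indicates the variable of integration; $I_E$ is the indicator function of the set $E$; convergence in norm means convergence in the operator norm on $L_p(\mathbb{R},\mu)$. The constants are $$\sigma_1=\int_{\alpha_1}^{\beta_1}(\sin(\omega s))^2d\mu_s,\qquad \sigma_2=\int_{\alpha_1}^{\beta_1}(\cos(\omega s))^2d\mu_s=\beta_1-\alpha_1-\sigma_1.$$ The parameter set is $$\Lambda=\Big\{(\theta_{A,1},\theta_{B,1},\theta_{B,3},\alpha_1,\beta_1,\alpha,\beta,\sigma_1,\sigma_2,\delta,\omega)\in\mathbb{R}^{11}:\ \delta\ne0,\ \alpha_1<\beta_1,\ \alpha\le\alpha_1,\ \beta\ge\beta_1,\ \int_{\alpha_1}^{\beta_1}\sin(\omega s)\cos(\omega s)d\mu_s=0,\ \sigma_1=\int_{\alpha_1}^{\beta_1}(\sin(\omega s))^2d\mu_s\ne0,\ \sigma_2=\beta_1-\alpha_1-\sigma_1\ne0\Big\},$$ and $\mathrm{cl}(\Lambda)$ is its closure in $\mathbb{R}^{11}$. Further, $\tilde\lambda=|\beta-\alpha|^{1/p}|\beta_1-\alpha_1|^{1/q}$ with $\frac1p+\frac1q=1$ if $1<p<\infty$, $\tilde\lambda=|\beta_1-\alpha_1|$ if $p=\infty$, and $\tilde\lambda=|\beta-\alpha|$ if $p=1$.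 *)

theory Defs
  imports "HOL-Analysis.Analysis" "HOL-Probability.Essential_Supremum"
begin

section \<open>The spaces \<open>L\<^sub>p\<close> on the real line and operators on them\<close>

text \<open>
  Elements of \<open>L\<^sub>p\<close> are represented by Lebesgue measurable functions, and identities between
  elements (or between operators) are identities almost everywhere. The exponent \<open>p\<close> is an extended
  nonnegative real, always used with \<open>1 \<le> p\<close>. The norm is extended-real valued, so that
  membership in \<open>L\<^sub>p\<close> is finiteness of the norm.
\<close>

definition Lp_norm :: "ennreal \<Rightarrow> (real \<Rightarrow> real) \<Rightarrow> ennreal" where
  "Lp_norm p f =
    (if p = \<infinity> then esssup lebesgue (\<lambda>t. ennreal \<bar>f t\<bar>)
     else let I = (\<integral>\<^sup>+ t. ennreal (\<bar>f t\<bar> powr enn2real p) \<partial>lebesgue)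
          in if I = \<infinity> then \<infinity> else ennreal (enn2real I powr (1 / enn2real p)))"

definition Lp_space :: "ennreal \<Rightarrow> (real \<Rightarrow> real) set" where
  "Lp_space p = {f \<in> borel_measurable lebesgue. Lp_norm p f < \<infinity>}"

type_synonym operator = "(real \<Rightarrow> real) \<Rightarrow> (real \<Rightarrow> real)"

text \<open>The second conjunct says that the map descends to almost-everywhere classes.\<close>

definition Lp_operator :: "ennreal \<Rightarrow> operator \<Rightarrow> bool" where
  "Lp_operator p T \<longleftrightarrow>
    (\<forall>x\<in>Lp_space p. T x \<in> Lp_space p) \<and>
    (\<forall>x\<in>Lp_space p. \<forall>y\<in>Lp_space p.
       (AE t in lebesgue. x t = y t) \<longrightarrow> (AE t in lebesgue. T x t = T y t))"

definition Lp_op_eq :: "ennreal \<Rightarrow> operator \<Rightarrow> operator \<Rightarrow> bool" where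
  "Lp_op_eq p S T \<longleftrightarrow> (\<forall>x\<in>Lp_space p. AE t in lebesgue. S x t = T x t)"

definition op_zero :: operator where
  "op_zero = (\<lambda>x t. 0)"

definition op_scale :: "real \<Rightarrow> operator \<Rightarrow> operator" where
  "op_scale c T = (\<lambda>x t. c * T x t)"

definition op_diff :: "operator \<Rightarrow> operator \<Rightarrow> operator" where
  "op_diff S T = (\<lambda>x t. S x t - T x t)"

definition op_comm :: "operator \<Rightarrow> operator \<Rightarrow> operator" where
  "op_comm S T = op_diff (S \<circ> T) (T \<circ> S)"

definition Lp_op_norm :: "ennreal \<Rightarrow> operator \<Rightarrow> ennreal" where
  "Lp_op_norm p T = (SUP x\<in>{x \<in> Lp_space p. Lp_norm p x \<le> 1}. Lp_norm p (T x))"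

definition tendsto_in_norm :: "ennreal \<Rightarrow> (nat \<Rightarrow> operator) \<Rightarrow> operator \<Rightarrow> bool" where
  "tendsto_in_norm p T S \<longleftrightarrow> (\<lambda>n. Lp_op_norm p (op_diff (T n) S)) \<longlonglongrightarrow> 0"


section \<open>The integral operators and their parameters\<close>

text \<open>
  For a bounded kernel \<open>k\<close> and \<open>x\<close> in \<open>L\<^sub>p\<close> the integrand is integrable by Hoelder's inequality, so the
  default value of the Bochner integral plays no role.
\<close>

definition kernel_op ::
    "real \<Rightarrow> real \<Rightarrow> real \<Rightarrow> real \<Rightarrow> (real \<Rightarrow> real \<Rightarrow> real) \<Rightarrow> operator" where
  "kernel_op \<alpha>\<^sub>1 \<beta>\<^sub>1 \<alpha> \<beta> k =
    (\<lambda>x t. LINT s:{\<alpha>\<^sub>1..\<beta>\<^sub>1}|lebesgue. indicator {\<alpha>..\<beta>} t * k t s * x s)"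

definition sigma1 :: "real \<Rightarrow> real \<Rightarrow> real \<Rightarrow> real" where
  "sigma1 \<alpha>\<^sub>1 \<beta>\<^sub>1 \<omega> = (LINT s:{\<alpha>\<^sub>1..\<beta>\<^sub>1}|lebesgue. (sin (\<omega> * s))\<^sup>2)"

definition sigma2 :: "real \<Rightarrow> real \<Rightarrow> real \<Rightarrow> real" where
  "sigma2 \<alpha>\<^sub>1 \<beta>\<^sub>1 \<omega> = (LINT s:{\<alpha>\<^sub>1..\<beta>\<^sub>1}|lebesgue. (cos (\<omega> * s))\<^sup>2)"

text \<open>
  Points of the 11-dimensional parameter space, in the order
  \<open>(\<theta>\<^sub>A\<^sub>1, \<theta>\<^sub>B\<^sub>1, \<theta>\<^sub>B\<^sub>3, \<alpha>\<^sub>1, \<beta>\<^sub>1, \<alpha>, \<beta>, \<sigma>\<^sub>1, \<sigma>\<^sub>2, \<delta>, \<omega>)\<close>; the product type carries the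
  Euclidean topology.
\<close>

type_synonym params =
  "real \<times> real \<times> real \<times> real \<times> real \<times> real \<times> real \<times> real \<times> real \<times> real \<times> real"

definition Lambda :: "params set" where
  "Lambda = {(\<theta>A1, \<theta>B1, \<theta>B3, \<alpha>\<^sub>1, \<beta>\<^sub>1, \<alpha>, \<beta>, \<sigma>\<^sub>1, \<sigma>\<^sub>2, \<delta>, \<omega>).
     \<delta> \<noteq> 0 \<and> \<alpha>\<^sub>1 < \<beta>\<^sub>1 \<and> \<alpha> \<le> \<alpha>\<^sub>1 \<and> \<beta>\<^sub>1 \<le> \<beta> \<and>
     (LINT s:{\<alpha>\<^sub>1..\<beta>\<^sub>1}|lebesgue. sin (\<omega> * s) * cos (\<omega> * s)) = 0 \<and>
     \<sigma>\<^sub>1 = (LINT s:{\<alpha>\<^sub>1..\<beta>\<^sub>1}|lebesgue. (sin (\<omega> * s))\<^sup>2) \<and> \<sigma>\<^sub>1 \<noteq> 0 \<and>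
     \<sigma>\<^sub>2 = \<beta>\<^sub>1 - \<alpha>\<^sub>1 - \<sigma>\<^sub>1 \<and> \<sigma>\<^sub>2 \<noteq> 0}"

text \<open>For \<open>1 < p < \<infinity>\<close> the solution of \<open>1/p + 1/q = 1\<close> is \<open>q = p/(p - 1)\<close>.\<close>

definition lambda_tilde :: "ennreal \<Rightarrow> real \<Rightarrow> real \<Rightarrow> real \<Rightarrow> real \<Rightarrow> real" where
  "lambda_tilde p \<alpha>\<^sub>1 \<beta>\<^sub>1 \<alpha> \<beta> =
    (if p = \<infinity> then \<bar>\<beta>\<^sub>1 - \<alpha>\<^sub>1\<bar>
     else if p = 1 then \<bar>\<beta> - \<alpha>\<bar>
     else let p' = enn2real p; q = p' / (p' - 1)
          in \<bar>\<beta> - \<alpha>\<bar> powr (1 / p') * \<bar>\<beta>\<^sub>1 - \<alpha>\<^sub>1\<bar> powr (1 / q))"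

definition op_A :: "real \<Rightarrow> real \<Rightarrow> real \<Rightarrow> real \<Rightarrow> real \<Rightarrow> real \<Rightarrow> operator" where
  "op_A \<theta> \<alpha>\<^sub>1 \<beta>\<^sub>1 \<alpha> \<beta> \<omega> =
    kernel_op \<alpha>\<^sub>1 \<beta>\<^sub>1 \<alpha> \<beta> (\<lambda>t s. \<theta> * sin (\<omega> * t) * cos (\<omega> * s))"

definition op_B :: "real \<Rightarrow> real \<Rightarrow> real \<Rightarrow> real \<Rightarrow> real \<Rightarrow> real \<Rightarrow> real \<Rightarrow> operator" where
  "op_B \<theta> \<theta>' \<alpha>\<^sub>1 \<beta>\<^sub>1 \<alpha> \<beta> \<omega> =
    kernel_op \<alpha>\<^sub>1 \<beta>\<^sub>1 \<alpha> \<beta>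
      (\<lambda>t s. \<theta> * sin (\<omega> * t) * cos (\<omega> * s) + \<theta>' * sin (\<omega> * t) * sin (\<omega> * s))"

end

theory Submission
  imports Defs
begin

text \<open>
  All operators here have rank at most one, with the same range vector. With
  \<open>u(t) = indicator {\<alpha>..\<beta>} t * sin (\<omega> t)\<close> and \<open>\<phi>\<^sub>g(x)\<close> the integral of \<open>g x\<close> over
  \<open>{\<alpha>\<^sub>1..\<beta>\<^sub>1}\<close>, each of them is \<open>x \<mapsto> \<phi>\<^sub>g(x) u\<close>, where \<open>g\<close> is a combination of
  \<open>cos (\<omega> s)\<close> and \<open>sin (\<omega> s)\<close>. A product of two such operators is therefore governed by the number
  \<open>\<phi>\<^sub>g(u)\<close>. As \<open>{\<alpha>\<^sub>1..\<beta>\<^sub>1} \<subseteq> {\<alpha>..\<beta>}\<close>, this is the integral of \<open>g(s) sin (\<omega> s)\<close> over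
  \<open>{\<alpha>\<^sub>1..\<beta>\<^sub>1}\<close>: it vanishes for the cosine, because the hypothesis on \<open>\<omega>\<close> makes sine and cosine
  orthogonal there, and it equals \<open>\<sigma>\<^sub>1\<close> for the sine. Hence \<open>A\<close> kills the common range, so that
  \<open>A B\<close> and \<open>A\<^sup>2\<close> vanish (lemma \<open>op_A_annihilates_range\<close>), and \<open>A B - B A = - B A\<close> is again of
  the same form, with \<open>g\<close> equal to \<open>- \<sigma>\<^sub>1 \<theta>\<^sub>A\<^sub>1 \<theta>\<^sub>B\<^sub>3 cos (\<omega> s)\<close> (lemma \<open>op_comm_op_A_op_B\<close>).

  All the limits come from one estimate, \<open>Lp_norm_sine_kernel_op_le\<close>: if \<open>\<bar>g\<bar> \<le> M\<close>, the operator
  \<open>x \<mapsto> \<phi>\<^sub>g(x) u\<close> has norm at most \<open>M\<close> times \<open>lambda_tilde\<close>. One factor of \<open>lambda_tilde\<close>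
  bounds the norm of \<open>u\<close>, the other comes from Hoelder's inequality on \<open>{\<alpha>\<^sub>1..\<beta>\<^sub>1}\<close>. In
  the limits along sequences, \<open>M\<close> is a constant times a coefficient that tends to zero; when the
  parameters move within \<open>Lambda\<close>, the product of \<open>M\<close> and \<open>lambda_tilde\<close> is, up to sign, the
  quantity assumed to tend to zero.
\<close>

section \<open>Norm estimates on intervals\<close>

lemma enn2real_ge_1:
  assumes "1 \<le> p" "p \<noteq> (\<infinity>::ennreal)"
  shows "1 \<le> enn2real p"
  using assms by (cases p) (auto simp: top_unique)

text \<open>
  Since \<open>enn2real \<infinity> = 0\<close> and \<open>1 / 0 = 0\<close>, the exponent \<open>1 / enn2real p\<close> has the right value also
  for \<open>p = \<infinity>\<close>, so that the three cases in the definition become one formula.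
\<close>

lemma lambda_tilde_eq:
  assumes "1 \<le> p" "a < b" "\<alpha> < \<beta>"
  shows "lambda_tilde p a b \<alpha> \<beta> =
    (\<beta> - \<alpha>) powr (1 / enn2real p) * (b - a) powr (1 - 1 / enn2real p)"
proof (cases "p = \<infinity>")
  case True
  then show ?thesis using assms by (simp add: lambda_tilde_def)
next
  case False
  have "1 \<le> enn2real p" by (rule enn2real_ge_1[OF assms(1) False])
  then have "1 / (enn2real p / (enn2real p - 1)) = 1 - 1 / enn2real p"
    by (simp add: field_simps)
  with False assms show ?thesis by (simp add: lambda_tilde_def Let_def)
qed

lemma Lp_norm_finite_exponent:
  assumes "p \<noteq> \<infinity>" "Lp_norm p x < \<infinity>"
  shows "(\<integral>\<^sup>+ t. ennreal (\<bar>x t\<bar> powr enn2real p) \<partial>lebesgue) < \<infinity>"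
    and "enn2real (Lp_norm p x) =
      enn2real (\<integral>\<^sup>+ t. ennreal (\<bar>x t\<bar> powr enn2real p) \<partial>lebesgue) powr (1 / enn2real p)"
  using assms by (auto simp: Lp_norm_def Let_def less_top split: if_splits)

lemma Lp_norm_le_indicator:
  assumes p: "1 \<le> p" and "\<alpha> < \<beta>" and c: "0 \<le> c"
    and f[measurable]: "f \<in> borel_measurable lebesgue"
    and le: "\<And>t. \<bar>f t\<bar> \<le> c * indicator {\<alpha>..\<beta>} t"
  shows "Lp_norm p f \<le> ennreal (c * (\<beta> - \<alpha>) powr (1 / enn2real p))"
proof (cases "p = \<infinity>")
  case True
  have "esssup lebesgue (\<lambda>t. ennreal \<bar>f t\<bar>) \<le> ennreal c"
  proof (rule esssup_I)
    have "\<bar>f t\<bar> \<le> c" for t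
      using le[of t] c by (cases "t \<in> {\<alpha>..\<beta>}") auto
    then show "AE t in lebesgue. ennreal \<bar>f t\<bar> \<le> ennreal c"
      by (intro AE_I2 ennreal_leI)
  qed simp
  with True assms(2) show ?thesis by (simp add: Lp_norm_def)
next
  case False
  define r where "r = enn2real p"
  have r: "1 \<le> r" unfolding r_def by (rule enn2real_ge_1[OF p False])
  define I where "I = (\<integral>\<^sup>+ t. ennreal (\<bar>f t\<bar> powr r) \<partial>lebesgue)"
  have "I \<le> (\<integral>\<^sup>+ t. ennreal (c powr r) * indicator {\<alpha>..\<beta>} t \<partial>lebesgue)"
    unfolding I_def
  proof (rule nn_integral_mono)
    fix t
    have "\<bar>f t\<bar> powr r \<le> c powr r" if "t \<in> {\<alpha>..\<beta>}"
      using le[of t] that r by (intro powr_mono2) auto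
    moreover have "f t = 0" if "t \<notin> {\<alpha>..\<beta>}" using le[of t] that by auto
    ultimately show "ennreal (\<bar>f t\<bar> powr r) \<le> ennreal (c powr r) * indicator {\<alpha>..\<beta>} t"
      by (auto simp: indicator_def intro!: ennreal_leI)
  qed
  also have "\<dots> = ennreal (c powr r * (\<beta> - \<alpha>))"
    using assms(2) by (simp add: nn_integral_cmult_indicator ennreal_mult)
  finally have I: "I \<le> ennreal (c powr r * (\<beta> - \<alpha>))" .
  then have "I \<noteq> \<infinity>" by (auto simp: top_unique)
  have "enn2real I \<le> c powr r * (\<beta> - \<alpha>)"
    using enn2real_mono[OF I] assms(2) by simp
  then have "enn2real I powr (1 / r) \<le> (c powr r * (\<beta> - \<alpha>)) powr (1 / r)"
    using r by (intro powr_mono2) auto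
  also have "\<dots> = c * (\<beta> - \<alpha>) powr (1 / r)"
    using r c assms(2) by (simp add: powr_mult powr_powr)
  finally have "enn2real I powr (1 / r) \<le> c * (\<beta> - \<alpha>) powr (1 / r)" .
  with \<open>I \<noteq> \<infinity>\<close> False show ?thesis
    by (auto simp: Lp_norm_def Let_def I_def[symmetric] r_def[symmetric] intro!: ennreal_leI)
qed

text \<open>
  Hoelder's inequality for the pair \<open>x\<close>, \<open>1\<close> on an interval. For \<open>1 < p < \<infinity>\<close> it is the integral
  of Young's inequality for \<open>\<bar>x s\<bar> / k\<close> and \<open>1\<close>, with \<open>k\<close> chosen below.
\<close>

lemma Holder_on_interval:
  assumes p: "1 \<le> p" and ab: "a < b" and x: "x \<in> Lp_space p"
  shows "(\<integral>\<^sup>+ s. ennreal \<bar>x s\<bar> * indicator {a..b} s \<partial>lebesgue)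
    \<le> ennreal (enn2real (Lp_norm p x) * (b - a) powr (1 - 1 / enn2real p))"
proof -
  define N where "N = enn2real (Lp_norm p x)"
  have N0: "0 \<le> N" by (simp add: N_def)
  have xm[measurable]: "x \<in> borel_measurable lebesgue" and fin: "Lp_norm p x < \<infinity>"
    using x by (auto simp: Lp_space_def)
  have N: "ennreal N = Lp_norm p x" using fin by (simp add: N_def less_top)
  have const: "(\<integral>\<^sup>+ s. ennreal c * indicator {a..b} s \<partial>lebesgue) = ennreal (c * (b - a))"
    if "0 \<le> c" for c
    using ab that by (simp add: nn_integral_cmult_indicator ennreal_mult)
  show ?thesis
  proof (cases "p = \<infinity>")
    case True
    have "AE s in lebesgue. ennreal \<bar>x s\<bar> \<le> ennreal N"
      using esssup_AE[of "\<lambda>s. ennreal \<bar>x s\<bar>" lebesgue] True by (simp add: N Lp_norm_def)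
    then have "AE s in lebesgue. ennreal \<bar>x s\<bar> * indicator {a..b} s
        \<le> ennreal N * indicator {a..b} s"
      by eventually_elim (rule mult_right_mono, auto)
    from nn_integral_mono_AE[OF this] const[OF N0] True ab show ?thesis
      by (simp add: N_def)
  next
    case False
    define r where "r = enn2real p"
    have r: "1 \<le> r" unfolding r_def by (rule enn2real_ge_1[OF p False])
    define I where "I = (\<integral>\<^sup>+ t. ennreal (\<bar>x t\<bar> powr r) \<partial>lebesgue)"
    define J where "J = enn2real I"
    have "I < \<infinity>" and NJ: "N = J powr (1 / r)"
      using Lp_norm_finite_exponent[OF False fin] by (auto simp: I_def r_def N_def J_def)
    then have IJ: "I = ennreal J" by (simp add: J_def)
    have J0: "0 \<le> J" by (simp add: J_def)
    consider "r = 1" | "r > 1" "J = 0" | "r > 1" "J > 0" using r J0 by linarith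
    then have "(\<integral>\<^sup>+ s. ennreal \<bar>x s\<bar> * indicator {a..b} s \<partial>lebesgue)
        \<le> ennreal (N * (b - a) powr (1 - 1 / r))"
    proof cases
      case 1
      have "(\<integral>\<^sup>+ s. ennreal \<bar>x s\<bar> * indicator {a..b} s \<partial>lebesgue) \<le> I"
        unfolding I_def using 1 by (intro nn_integral_mono) (auto simp: indicator_def)
      with 1 show ?thesis using J0 ab by (simp add: NJ IJ)
    next
      case 2
      then have "I = 0" using IJ by simp
      then have "AE s in lebesgue. ennreal (\<bar>x s\<bar> powr r) = 0"
        unfolding I_def by (subst (asm) nn_integral_0_iff_AE) auto
      then have "AE s in lebesgue. ennreal \<bar>x s\<bar> * indicator {a..b} s = 0"
        by eventually_elim (auto simp: ennreal_eq_0_iff)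
      then have "(\<integral>\<^sup>+ s. ennreal \<bar>x s\<bar> * indicator {a..b} s \<partial>lebesgue) = 0"
        by (subst nn_integral_0_iff_AE)
          (auto intro!: borel_measurable_times_ennreal borel_measurable_indicator)
      then show ?thesis by simp
    next
      case 3
      define l where "l = b - a"
      have l: "0 < l" using ab by (simp add: l_def)
      define q where "q = r / (r - 1)"
      have q: "1 < q" "1 / r + 1 / q = 1" "1 / q = 1 - 1 / r"
        using 3 by (auto simp: q_def field_simps)
      have Npos: "0 < N" using 3 by (simp add: NJ)
      have NrJ: "N powr r = J" using 3 by (simp add: NJ powr_powr)
      \<comment> \<open>This makes the integral of \<open>(\<bar>x s\<bar> / k) powr r\<close> over the line equal to the length \<open>l\<close>, so the
        two terms of Young's inequality contribute \<open>l / r\<close> and \<open>l / q\<close>, of sum \<open>l\<close>.\<close>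
      define k where "k = N / l powr (1 / r)"
      have k: "0 < k" using Npos l by (simp add: k_def)
      have kr: "k powr r = J / l"
        using 3 l Npos by (simp add: k_def powr_divide powr_powr NrJ)
      define K where "K = k / (r * (J / l))"
      have K: "0 \<le> K" using k l 3 by (simp add: K_def)
      have Young: "\<bar>x s\<bar> \<le> k / q + K * \<bar>x s\<bar> powr r" for s
      proof -
        have "(\<bar>x s\<bar> / k) * 1 \<le> (\<bar>x s\<bar> / k) powr r / r + 1 powr q / q"
          using Youngs_inequality[of r q "\<bar>x s\<bar> / k" 1] 3 q k by simp
        also have "(\<bar>x s\<bar> / k) powr r = \<bar>x s\<bar> powr r / (J / l)"
          using k by (simp add: powr_divide kr)
        finally have "k * (\<bar>x s\<bar> / k) \<le> k * (\<bar>x s\<bar> powr r / (J / l) / r + 1 / q)"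
          using k by (intro mult_left_mono) auto
        then show ?thesis using k by (simp add: K_def algebra_simps)
      qed
      have "(\<integral>\<^sup>+ s. ennreal \<bar>x s\<bar> * indicator {a..b} s \<partial>lebesgue)
        \<le> (\<integral>\<^sup>+ s. ennreal (k / q) * indicator {a..b} s
              + ennreal (K) * ennreal (\<bar>x s\<bar> powr r) \<partial>lebesgue)"
      proof (rule nn_integral_mono)
        fix s
        have "ennreal \<bar>x s\<bar> \<le> ennreal (k / q + K * \<bar>x s\<bar> powr r)"
          by (rule ennreal_leI[OF Young])
        also have "\<dots> = ennreal (k / q) + ennreal (K) * ennreal (\<bar>x s\<bar> powr r)"
          using k q K by (simp add: ennreal_plus ennreal_mult)
        finally show "ennreal \<bar>x s\<bar> * indicator {a..b} s \<le> ennreal (k / q) * indicator {a..b} s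
            + ennreal (K) * ennreal (\<bar>x s\<bar> powr r)"
          by (auto simp: indicator_def)
      qed
      also have "\<dots> = ennreal (k / q * l) + ennreal (K) * ennreal J"
        using k q by (subst nn_integral_add)
          (auto simp: nn_integral_cmult const l_def IJ[symmetric] I_def
            intro!: borel_measurable_times_ennreal borel_measurable_indicator)
      also have "\<dots> = ennreal (k / q * l + K * J)"
        using k q l K J0 by (simp add: ennreal_plus ennreal_mult)
      also have "k / q * l + K * J = k * l * (1 / r + 1 / q)"
        using 3 l by (simp add: K_def field_simps)
      also have "\<dots> = N * l powr (1 - 1 / r)"
        using l q by (simp add: k_def powr_diff)
      finally show ?thesis by (simp add: l_def)
    qed
    then show ?thesis by (simp add: N_def r_def)
  qed
qed

lemma Lp_space_set_integrable:
  assumes "1 \<le> p" "a < b" "x \<in> Lp_space p"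
  shows "set_integrable lebesgue {a..b} x"
  unfolding set_integrable_def
proof (rule integrableI_bounded)
  have [measurable]: "x \<in> borel_measurable lebesgue" using assms by (simp add: Lp_space_def)
  show "(\<lambda>s. indicat_real {a..b} s *\<^sub>R x s) \<in> borel_measurable lebesgue"
    by (intro borel_measurable_scaleR borel_measurable_indicator) auto
  have "(\<integral>\<^sup>+ s. ennreal (norm (indicat_real {a..b} s *\<^sub>R x s)) \<partial>lebesgue)
      = (\<integral>\<^sup>+ s. ennreal \<bar>x s\<bar> * indicator {a..b} s \<partial>lebesgue)"
    by (intro nn_integral_cong) (auto simp: indicator_def)
  also have "\<dots> < \<infinity>"
    using Holder_on_interval[OF assms] by (simp add: le_less_trans)
  finally show "(\<integral>\<^sup>+ s. ennreal (norm (indicat_real {a..b} s *\<^sub>R x s)) \<partial>lebesgue) < \<infinity>" .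
qed

lemma set_integrable_bounded_mult:
  fixes g x :: "real \<Rightarrow> real"
  assumes x: "set_integrable lebesgue {a..b} x"
    and g: "g \<in> borel_measurable lebesgue" and M: "\<And>s. \<bar>g s\<bar> \<le> M"
  shows "set_integrable lebesgue {a..b} (\<lambda>s. g s * x s)"
  unfolding set_integrable_def
proof (rule Bochner_Integration.integrable_bound)
  have i: "integrable lebesgue (\<lambda>s. indicator {a..b} s *\<^sub>R x s)"
    using x by (simp add: set_integrable_def)
  then show "integrable lebesgue (\<lambda>s. M * (indicator {a..b} s *\<^sub>R x s))" by simp
  have "(\<lambda>s. g s * (indicator {a..b} s *\<^sub>R x s)) \<in> borel_measurable lebesgue"
    using g borel_measurable_integrable[OF i] by (rule borel_measurable_times)
  then show "(\<lambda>s. indicat_real {a..b} s *\<^sub>R (g s * x s)) \<in> borel_measurable lebesgue"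
    by (simp add: mult_ac)
  have "\<bar>g s\<bar> * \<bar>y\<bar> \<le> \<bar>M\<bar> * \<bar>y\<bar>" for s y
    using M[of s] by (intro mult_right_mono) auto
  then show "AE s in lebesgue. norm (indicat_real {a..b} s *\<^sub>R (g s * x s))
      \<le> norm (M * (indicator {a..b} s *\<^sub>R x s))"
    by (intro AE_I2) (auto simp: abs_mult indicator_def)
qed

section \<open>Separable kernels\<close>

text \<open>The functional \<open>\<phi>\<^sub>g\<close> and the common range vector \<open>u\<close>.\<close>

definition moment :: "real \<Rightarrow> real \<Rightarrow> (real \<Rightarrow> real) \<Rightarrow> (real \<Rightarrow> real) \<Rightarrow> real" where
  "moment a b g x = (LINT s:{a..b}|lebesgue. g s * x s)"

definition windowed_sine :: "real \<Rightarrow> real \<Rightarrow> real \<Rightarrow> real \<Rightarrow> real" where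
  "windowed_sine \<alpha> \<beta> \<omega> t = indicator {\<alpha>..\<beta>} t * sin (\<omega> * t)"

definition sine_kernel_op ::
    "real \<Rightarrow> real \<Rightarrow> real \<Rightarrow> real \<Rightarrow> real \<Rightarrow> (real \<Rightarrow> real) \<Rightarrow> operator" where
  "sine_kernel_op a b \<alpha> \<beta> \<omega> g = (\<lambda>x t. moment a b g x * windowed_sine \<alpha> \<beta> \<omega> t)"

lemma kernel_op_separable:
  "kernel_op a b \<alpha> \<beta> (\<lambda>t s. sin (\<omega> * t) * g s) = sine_kernel_op a b \<alpha> \<beta> \<omega> g"
proof (intro ext)
  fix x t
  have "(LINT s:{a..b}|lebesgue. indicator {\<alpha>..\<beta>} t * (sin (\<omega> * t) * g s) * x s)
      = (LINT s:{a..b}|lebesgue. windowed_sine \<alpha> \<beta> \<omega> t * (g s * x s))"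
    by (simp add: windowed_sine_def mult_ac)
  also have "\<dots> = windowed_sine \<alpha> \<beta> \<omega> t * moment a b g x"
    by (simp add: moment_def)
  finally show "kernel_op a b \<alpha> \<beta> (\<lambda>t s. sin (\<omega> * t) * g s) x t
      = sine_kernel_op a b \<alpha> \<beta> \<omega> g x t"
    by (simp add: kernel_op_def sine_kernel_op_def mult_ac)
qed

lemma op_A_eq: "op_A \<theta> a b \<alpha> \<beta> \<omega> = sine_kernel_op a b \<alpha> \<beta> \<omega> (\<lambda>s. \<theta> * cos (\<omega> * s))"
  unfolding op_A_def kernel_op_separable[symmetric] by (simp add: mult_ac)

lemma op_B_eq: "op_B \<theta> \<theta>' a b \<alpha> \<beta> \<omega> =
    sine_kernel_op a b \<alpha> \<beta> \<omega> (\<lambda>s. \<theta> * cos (\<omega> * s) + \<theta>' * sin (\<omega> * s))"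
  unfolding op_B_def kernel_op_separable[symmetric] by (simp add: algebra_simps)

lemma moment_scale_left: "moment a b (\<lambda>s. c * g s) x = c * moment a b g x"
  by (simp add: moment_def mult.assoc)

lemma moment_windowed_sine:
  assumes "\<alpha> \<le> a" "b \<le> \<beta>"
  shows "moment a b g (\<lambda>t. c * windowed_sine \<alpha> \<beta> \<omega> t) = c * moment a b g (\<lambda>t. sin (\<omega> * t))"
proof -
  have "moment a b g (\<lambda>t. c * windowed_sine \<alpha> \<beta> \<omega> t)
      = (LINT s:{a..b}|lebesgue. c * (g s * sin (\<omega> * s)))"
    unfolding moment_def using assms
    by (intro set_lebesgue_integral_cong) (auto simp: windowed_sine_def)
  then show ?thesis by (simp add: moment_def)
qed

text \<open>
  On \<open>{a..b}\<close> the range vector is the full sine, so composing two of these operators multiplies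
  the inner one by the moment of \<open>sin (\<omega> t)\<close> against the outer kernel.
\<close>

lemma sine_kernel_op_comp:
  assumes "\<alpha> \<le> a" "b \<le> \<beta>"
  shows "sine_kernel_op a b \<alpha> \<beta> \<omega> g (sine_kernel_op a b \<alpha> \<beta> \<omega> h x) =
    (\<lambda>t. moment a b h x * moment a b g (\<lambda>t. sin (\<omega> * t)) * windowed_sine \<alpha> \<beta> \<omega> t)"
  unfolding sine_kernel_op_def[of a b \<alpha> \<beta> \<omega> h] sine_kernel_op_def[of a b \<alpha> \<beta> \<omega> g]
  by (simp add: moment_windowed_sine[OF assms])

lemma lebesgue_measurable_continuous:
  fixes g :: "real \<Rightarrow> real"
  shows "continuous_on UNIV g \<Longrightarrow> g \<in> borel_measurable lebesgue"
  by (intro measurable_completion) (simp add: borel_measurable_continuous_onI)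

lemma moment_cos_sin:
  assumes x: "set_integrable lebesgue {a..b} x"
  shows "moment a b (\<lambda>s. c * cos (\<omega> * s) + d * sin (\<omega> * s)) x
    = c * moment a b (\<lambda>s. cos (\<omega> * s)) x + d * moment a b (\<lambda>s. sin (\<omega> * s)) x"
proof -
  have "set_integrable lebesgue {a..b} (\<lambda>s. (c * cos (\<omega> * s)) * x s)"
    by (rule set_integrable_bounded_mult[OF x, where M = "\<bar>c\<bar>"])
      (auto intro!: lebesgue_measurable_continuous continuous_intros
        simp: abs_mult mult_left_le)
  moreover have "set_integrable lebesgue {a..b} (\<lambda>s. (d * sin (\<omega> * s)) * x s)"
    by (rule set_integrable_bounded_mult[OF x, where M = "\<bar>d\<bar>"])
      (auto intro!: lebesgue_measurable_continuous continuous_intros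
        simp: abs_mult mult_left_le)
  ultimately show ?thesis
    unfolding moment_def by (simp add: ring_distribs mult.assoc)
qed

lemma set_integrable_sine:
  fixes a b \<omega> :: real
  shows "set_integrable lebesgue {a..b} (\<lambda>s. sin (\<omega> * s))"
  by (intro absolutely_integrable_continuous_real continuous_intros)

text \<open>
  The primitive \<open>sin\<^sup>2 (\<omega> s) / (2 \<omega>)\<close> and
  \<open>sin\<^sup>2 x - sin\<^sup>2 y = sin (x + y) sin (x - y)\<close> turn either alternative of the condition on \<open>\<omega>\<close>
  into orthogonality.
\<close>

lemma sine_cosine_orthogonal:
  assumes ab: "a \<le> b" and \<omega>: "\<omega> / pi * (b - a) \<in> \<int> \<or> \<omega> / pi * (b + a) \<in> \<int>"
  shows "moment a b (\<lambda>s. cos (\<omega> * s)) (\<lambda>s. sin (\<omega> * s)) = 0"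
proof (cases "\<omega> = 0")
  case True
  then show ?thesis by (simp add: moment_def)
next
  case False
  define F where "F s = (sin (\<omega> * s))\<^sup>2 / (2 * \<omega>)" for s
  have "(LBINT s. (cos (\<omega> * s) * sin (\<omega> * s)) * indicator {a..b} s) = F b - F a"
  proof (rule integral_FTC_Icc_real[OF ab])
    show "DERIV F s :> cos (\<omega> * s) * sin (\<omega> * s)" for s
      unfolding F_def using False
      by (auto intro!: derivative_eq_intros simp: field_simps power2_eq_square)
  qed (intro continuous_intros)
  moreover have "moment a b (\<lambda>s. cos (\<omega> * s)) (\<lambda>s. sin (\<omega> * s))
      = (LBINT s. (cos (\<omega> * s) * sin (\<omega> * s)) * indicator {a..b} s)"
    unfolding moment_def set_lebesgue_integral_def
    by (subst integral_completion) (auto simp: mult_ac)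
  moreover have "F b - F a = sin (\<omega> * (b + a)) * sin (\<omega> * (b - a)) / (2 * \<omega>)"
  proof -
    have "(sin x)\<^sup>2 - (sin y)\<^sup>2 = sin (x + y) * sin (x - y)" for x y :: real
    proof -
      have "sin (x + y) * sin (x - y) = (sin x)\<^sup>2 * (cos y)\<^sup>2 - (cos x)\<^sup>2 * (sin y)\<^sup>2"
        by (simp add: sin_add sin_diff algebra_simps power2_eq_square)
      then show ?thesis by (simp add: cos_squared_eq algebra_simps)
    qed
    then show ?thesis by (simp add: F_def diff_divide_distrib[symmetric] ring_distribs)
  qed
  moreover have "sin (\<omega> * c) = 0" if int: "\<omega> / pi * c \<in> \<int>" for c
  proof -
    from int obtain k where "\<omega> / pi * c = of_int k" by (elim Ints_cases)
    then have "\<omega> * c = of_int k * pi" by (simp add: field_simps)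
    then show ?thesis by (auto simp: sin_zero_iff_int2)
  qed
  ultimately show ?thesis using \<omega> by auto
qed

section \<open>The operator bound\<close>

lemma moment_bound:
  assumes p: "1 \<le> p" and ab: "a < b" and x: "x \<in> Lp_space p"
    and g: "g \<in> borel_measurable lebesgue" and M: "\<And>s. \<bar>g s\<bar> \<le> M"
  shows "\<bar>moment a b g x\<bar> \<le> M * (enn2real (Lp_norm p x) * (b - a) powr (1 - 1 / enn2real p))"
    (is "_ \<le> M * ?H")
proof -
  have [measurable]: "x \<in> borel_measurable lebesgue" using x by (simp add: Lp_space_def)
  have M0: "0 \<le> M" using M[of 0] by linarith
  have "integrable lebesgue (\<lambda>s. indicat_real {a..b} s *\<^sub>R (g s * x s))"
    using set_integrable_bounded_mult[OF Lp_space_set_integrable[OF p ab x] g M]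
    by (simp add: set_integrable_def)
  then have "ennreal \<bar>moment a b g x\<bar>
      \<le> (\<integral>\<^sup>+ s. ennreal (norm (indicat_real {a..b} s *\<^sub>R (g s * x s))) \<partial>lebesgue)"
    unfolding moment_def set_lebesgue_integral_def real_norm_def[symmetric]
    by (rule integral_norm_bound_ennreal)
  also have "\<dots> \<le> (\<integral>\<^sup>+ s. ennreal M * (ennreal \<bar>x s\<bar> * indicator {a..b} s) \<partial>lebesgue)"
  proof (rule nn_integral_mono)
    fix s
    have "\<bar>g s\<bar> * \<bar>x s\<bar> \<le> M * \<bar>x s\<bar>" by (intro mult_right_mono M) auto
    then show "ennreal (norm (indicat_real {a..b} s *\<^sub>R (g s * x s)))
        \<le> ennreal M * (ennreal \<bar>x s\<bar> * indicator {a..b} s)"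
      using M0 by (auto simp: indicator_def abs_mult ennreal_mult[symmetric] intro!: ennreal_leI)
  qed
  also have "\<dots> = ennreal M * (\<integral>\<^sup>+ s. ennreal \<bar>x s\<bar> * indicator {a..b} s \<partial>lebesgue)"
    by (intro nn_integral_cmult borel_measurable_times_ennreal borel_measurable_indicator) auto
  also have "\<dots> \<le> ennreal M * ennreal ?H"
    by (intro mult_left_mono Holder_on_interval[OF p ab x]) auto
  also have "\<dots> = ennreal (M * ?H)" using M0 by (simp add: ennreal_mult)
  finally show ?thesis using M0 by (subst (asm) ennreal_le_iff) auto
qed

lemma windowed_sine_measurable [measurable]: "windowed_sine \<alpha> \<beta> \<omega> \<in> borel_measurable lebesgue"
  unfolding windowed_sine_def[abs_def]
  by (intro borel_measurable_times borel_measurable_indicator)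
    (auto intro!: lebesgue_measurable_continuous continuous_intros)

text \<open>
  The two powers of interval lengths that make up \<open>lambda_tilde\<close> come from different sources: that
  of \<open>b - a\<close> from the functional, by Hoelder's inequality, that of \<open>\<beta> - \<alpha>\<close> from the norm of the
  range vector, which is at most that of an indicator.
\<close>

lemma Lp_norm_sine_kernel_op_le:
  assumes p: "1 \<le> p" and ab: "a < b" and \<alpha>\<beta>: "\<alpha> < \<beta>" and x: "x \<in> Lp_space p"
    and g: "continuous_on UNIV g" and M: "\<And>s. \<bar>g s\<bar> \<le> M"
  shows "Lp_norm p (sine_kernel_op a b \<alpha> \<beta> \<omega> g x)
    \<le> ennreal (M * lambda_tilde p a b \<alpha> \<beta>) * Lp_norm p x"
proof -
  let ?H = "enn2real (Lp_norm p x) * (b - a) powr (1 - 1 / enn2real p)"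
  have M0: "0 \<le> M" using M[of 0] by linarith
  have fin: "Lp_norm p x < \<infinity>" using x by (simp add: Lp_space_def)
  have "Lp_norm p (sine_kernel_op a b \<alpha> \<beta> \<omega> g x)
      \<le> ennreal ((M * ?H) * (\<beta> - \<alpha>) powr (1 / enn2real p))"
  proof (rule Lp_norm_le_indicator[OF p \<alpha>\<beta>])
    show "sine_kernel_op a b \<alpha> \<beta> \<omega> g x \<in> borel_measurable lebesgue"
      unfolding sine_kernel_op_def by measurable
    show "0 \<le> M * ?H" using M0 by simp
    fix t
    have "\<bar>moment a b g x\<bar> * \<bar>windowed_sine \<alpha> \<beta> \<omega> t\<bar> \<le> (M * ?H) * indicator {\<alpha>..\<beta>} t"
      by (intro mult_mono moment_bound[OF p ab x] lebesgue_measurable_continuous g M)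
        (use M0 in \<open>auto simp: windowed_sine_def indicator_def\<close>)
    then show "\<bar>sine_kernel_op a b \<alpha> \<beta> \<omega> g x t\<bar> \<le> (M * ?H) * indicator {\<alpha>..\<beta>} t"
      by (simp add: sine_kernel_op_def abs_mult)
  qed
  also have "(M * ?H) * (\<beta> - \<alpha>) powr (1 / enn2real p)
      = (M * lambda_tilde p a b \<alpha> \<beta>) * enn2real (Lp_norm p x)"
    by (simp add: lambda_tilde_eq[OF p ab \<alpha>\<beta>] mult_ac)
  also have "ennreal \<dots> = ennreal (M * lambda_tilde p a b \<alpha> \<beta>) * Lp_norm p x"
    using M0 fin by (simp add: ennreal_mult lambda_tilde_eq[OF p ab \<alpha>\<beta>] less_top)
  finally show ?thesis .
qed

lemma Lp_operator_sine_kernel_op: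
  assumes p: "1 \<le> p" and ab: "a < b" and \<alpha>\<beta>: "\<alpha> < \<beta>"
    and g: "continuous_on UNIV g" and M: "\<And>s. \<bar>g s\<bar> \<le> M"
  shows "Lp_operator p (sine_kernel_op a b \<alpha> \<beta> \<omega> g)"
  unfolding Lp_operator_def
proof (intro conjI ballI impI)
  fix x assume x: "x \<in> Lp_space p"
  have "Lp_norm p (sine_kernel_op a b \<alpha> \<beta> \<omega> g x)
      \<le> ennreal (M * lambda_tilde p a b \<alpha> \<beta>) * Lp_norm p x"
    by (rule Lp_norm_sine_kernel_op_le[OF p ab \<alpha>\<beta> x g M])
  also have "\<dots> < \<infinity>" using x by (simp add: Lp_space_def ennreal_mult_less_top)
  finally show "sine_kernel_op a b \<alpha> \<beta> \<omega> g x \<in> Lp_space p"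
    unfolding Lp_space_def sine_kernel_op_def by simp
next
  fix x y assume "x \<in> Lp_space p" "y \<in> Lp_space p" and xy: "AE t in lebesgue. x t = y t"
  then have [measurable]: "x \<in> borel_measurable lebesgue" "y \<in> borel_measurable lebesgue"
    by (auto simp: Lp_space_def)
  have [measurable]: "g \<in> borel_measurable lebesgue"
    by (rule lebesgue_measurable_continuous[OF g])
  have "moment a b g x = moment a b g y"
    unfolding moment_def set_lebesgue_integral_def
  proof (rule integral_cong_AE)
    show "AE s in lebesgue. indicat_real {a..b} s *\<^sub>R (g s * x s)
        = indicat_real {a..b} s *\<^sub>R (g s * y s)"
      using xy by eventually_elim simp
  qed (auto intro!: borel_measurable_scaleR borel_measurable_times borel_measurable_indicator)
  then show "AE t in lebesgue. sine_kernel_op a b \<alpha> \<beta> \<omega> g x t = sine_kernel_op a b \<alpha> \<beta> \<omega> g y t"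
    by (simp add: sine_kernel_op_def)
qed

lemma tendsto_in_norm_sine_kernel_op:
  assumes p: "1 \<le> p" and ab: "a < b" and \<alpha>\<beta>: "\<alpha> < \<beta>"
    and eq: "\<And>n x. x \<in> Lp_space p \<Longrightarrow>
      op_diff (T n) S x = sine_kernel_op a b \<alpha> \<beta> \<omega> (g n) x"
    and g: "\<And>n. continuous_on UNIV (g n)" and M: "\<And>n s. \<bar>g n s\<bar> \<le> M n" and lim: "M \<longlonglongrightarrow> 0"
  shows "tendsto_in_norm p T S"
  unfolding tendsto_in_norm_def
proof (rule tendsto_sandwich[of "\<lambda>_. 0" _ _ "\<lambda>n. ennreal (M n * lambda_tilde p a b \<alpha> \<beta>)"])
  have "Lp_op_norm p (op_diff (T n) S) \<le> ennreal (M n * lambda_tilde p a b \<alpha> \<beta>)" for n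
    unfolding Lp_op_norm_def
  proof (rule SUP_least)
    fix x assume x: "x \<in> {x \<in> Lp_space p. Lp_norm p x \<le> 1}"
    then have "Lp_norm p (op_diff (T n) S x)
        \<le> ennreal (M n * lambda_tilde p a b \<alpha> \<beta>) * Lp_norm p x"
      using Lp_norm_sine_kernel_op_le[OF p ab \<alpha>\<beta> _ g M] by (simp add: eq)
    also have "\<dots> \<le> ennreal (M n * lambda_tilde p a b \<alpha> \<beta>) * 1"
      using x by (intro mult_left_mono) auto
    finally show "Lp_norm p (op_diff (T n) S x) \<le> ennreal (M n * lambda_tilde p a b \<alpha> \<beta>)"
      by simp
  qed
  then show "\<forall>\<^sub>F n in sequentially. Lp_op_norm p (op_diff (T n) S)
      \<le> ennreal (M n * lambda_tilde p a b \<alpha> \<beta>)"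
    by simp
  have "(\<lambda>n. ennreal (M n * lambda_tilde p a b \<alpha> \<beta>)) \<longlonglongrightarrow> ennreal (0 * lambda_tilde p a b \<alpha> \<beta>)"
    by (intro tendsto_intros lim)
  then show "(\<lambda>n. ennreal (M n * lambda_tilde p a b \<alpha> \<beta>)) \<longlonglongrightarrow> 0" by simp
qed auto

section \<open>Products and commutators\<close>

context
  fixes a b \<alpha> \<beta> \<omega> :: real
  assumes window: "\<alpha> \<le> a" "b \<le> \<beta>"
    and orth: "moment a b (\<lambda>s. cos (\<omega> * s)) (\<lambda>s. sin (\<omega> * s)) = 0"
begin

lemma op_A_annihilates_range:
  "op_A \<theta> a b \<alpha> \<beta> \<omega> (sine_kernel_op a b \<alpha> \<beta> \<omega> g x) = (\<lambda>t. 0)"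
  by (simp add: op_A_eq sine_kernel_op_comp[OF window] moment_scale_left orth)

text \<open>
  Applied to the range vector, the cosine part of \<open>B\<close> vanishes by orthogonality, so \<open>\<theta>B1\<close>
  drops out; the sine part gives \<open>sigma1\<close>.
\<close>

lemma op_B_op_A:
  "op_B \<theta>B1 \<theta>B3 a b \<alpha> \<beta> \<omega> (op_A \<theta> a b \<alpha> \<beta> \<omega> x) =
    sine_kernel_op a b \<alpha> \<beta> \<omega> (\<lambda>s. sigma1 a b \<omega> * \<theta> * \<theta>B3 * cos (\<omega> * s)) x"
proof -
  have "moment a b (\<lambda>s. sin (\<omega> * s)) (\<lambda>s. sin (\<omega> * s)) = sigma1 a b \<omega>"
    by (simp add: moment_def sigma1_def power2_eq_square)
  then have "moment a b (\<lambda>s. \<theta>B1 * cos (\<omega> * s) + \<theta>B3 * sin (\<omega> * s)) (\<lambda>s. sin (\<omega> * s))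
      = \<theta>B3 * sigma1 a b \<omega>"
    by (simp add: moment_cos_sin[OF set_integrable_sine] orth)
  then have "op_B \<theta>B1 \<theta>B3 a b \<alpha> \<beta> \<omega> (op_A \<theta> a b \<alpha> \<beta> \<omega> x) =
      (\<lambda>t. \<theta> * moment a b (\<lambda>s. cos (\<omega> * s)) x * (\<theta>B3 * sigma1 a b \<omega>)
        * windowed_sine \<alpha> \<beta> \<omega> t)"
    by (simp only: op_A_eq op_B_eq sine_kernel_op_comp[OF window] moment_scale_left)
  then show ?thesis
    by (simp only: sine_kernel_op_def moment_scale_left) (simp add: mult_ac)
qed

lemma op_comm_op_A_op_B:
  "op_comm (op_A \<theta> a b \<alpha> \<beta> \<omega>) (op_B \<theta>B1 \<theta>B3 a b \<alpha> \<beta> \<omega>) x =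
    sine_kernel_op a b \<alpha> \<beta> \<omega> (\<lambda>s. - sigma1 a b \<omega> * \<theta> * \<theta>B3 * cos (\<omega> * s)) x"
proof -
  have "op_A \<theta> a b \<alpha> \<beta> \<omega> (op_B \<theta>B1 \<theta>B3 a b \<alpha> \<beta> \<omega> x) = (\<lambda>t. 0)"
    by (simp add: op_B_eq op_A_annihilates_range)
  then show ?thesis
    by (simp only: op_comm_def op_diff_def comp_def op_B_op_A sine_kernel_op_def moment_scale_left)
      simp
qed

lemma op_A_op_B_relations:
  "Lp_op_eq p (op_A \<theta> a b \<alpha> \<beta> \<omega> \<circ> op_B \<theta>B1 \<theta>B3 a b \<alpha> \<beta> \<omega>)
    (op_scale \<delta> (op_B \<theta>B1 \<theta>B3 a b \<alpha> \<beta> \<omega> \<circ> op_A \<theta> a b \<alpha> \<beta> \<omega> ^^ 2))"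
  "Lp_op_eq p (op_scale \<delta> (op_B \<theta>B1 \<theta>B3 a b \<alpha> \<beta> \<omega> \<circ> op_A \<theta> a b \<alpha> \<beta> \<omega> ^^ 2)) op_zero"
proof -
  have "op_A \<theta> a b \<alpha> \<beta> \<omega> (op_A \<theta> a b \<alpha> \<beta> \<omega> x) = (\<lambda>t. 0)" for x
    by (subst (2) op_A_eq) (rule op_A_annihilates_range)
  moreover have "op_B \<theta>B1 \<theta>B3 a b \<alpha> \<beta> \<omega> (\<lambda>t. 0) = (\<lambda>t. 0)"
    by (simp add: op_B_eq sine_kernel_op_def moment_def)
  moreover have "op_A \<theta> a b \<alpha> \<beta> \<omega> (op_B \<theta>B1 \<theta>B3 a b \<alpha> \<beta> \<omega> x) = (\<lambda>t. 0)" for x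
    by (simp add: op_B_eq op_A_annihilates_range)
  ultimately show
    "Lp_op_eq p (op_A \<theta> a b \<alpha> \<beta> \<omega> \<circ> op_B \<theta>B1 \<theta>B3 a b \<alpha> \<beta> \<omega>)
      (op_scale \<delta> (op_B \<theta>B1 \<theta>B3 a b \<alpha> \<beta> \<omega> \<circ> op_A \<theta> a b \<alpha> \<beta> \<omega> ^^ 2))"
    "Lp_op_eq p (op_scale \<delta> (op_B \<theta>B1 \<theta>B3 a b \<alpha> \<beta> \<omega> \<circ> op_A \<theta> a b \<alpha> \<beta> \<omega> ^^ 2)) op_zero"
    by (simp_all add: Lp_op_eq_def op_scale_def op_zero_def numeral_2_eq_2)
qed

lemma Lp_norm_op_comm_le:
  assumes "1 \<le> p" "a < b" "\<alpha> < \<beta>" "x \<in> Lp_space p"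
  shows "Lp_norm p (op_comm (op_A \<theta> a b \<alpha> \<beta> \<omega>) (op_B \<theta>B1 \<theta>B3 a b \<alpha> \<beta> \<omega>) x)
    \<le> ennreal \<bar>\<theta>B3 * \<theta> * sigma1 a b \<omega> * lambda_tilde p a b \<alpha> \<beta>\<bar> * Lp_norm p x"
proof -
  have "\<bar>\<theta>B3 * \<theta> * sigma1 a b \<omega> * lambda_tilde p a b \<alpha> \<beta>\<bar>
      = \<bar>- sigma1 a b \<omega> * \<theta> * \<theta>B3\<bar> * lambda_tilde p a b \<alpha> \<beta>"
    using assms by (simp add: lambda_tilde_eq abs_mult mult_ac)
  moreover have "Lp_norm p (op_comm (op_A \<theta> a b \<alpha> \<beta> \<omega>) (op_B \<theta>B1 \<theta>B3 a b \<alpha> \<beta> \<omega>) x)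
      \<le> ennreal (\<bar>- sigma1 a b \<omega> * \<theta> * \<theta>B3\<bar> * lambda_tilde p a b \<alpha> \<beta>) * Lp_norm p x"
    unfolding op_comm_op_A_op_B using assms
    by (intro Lp_norm_sine_kernel_op_le continuous_intros) (auto simp: abs_mult mult_left_le)
  ultimately show ?thesis by simp
qed

lemma tendsto_in_norm_op_comm:
  assumes "1 \<le> p" "a < b" "\<alpha> < \<beta>" and lim: "(\<lambda>n. \<theta> n * \<theta>B3 n) \<longlonglongrightarrow> 0"
  shows "tendsto_in_norm p
    (\<lambda>n. op_comm (op_A (\<theta> n) a b \<alpha> \<beta> \<omega>) (op_B \<theta>B1 (\<theta>B3 n) a b \<alpha> \<beta> \<omega>)) op_zero"
proof (rule tendsto_in_norm_sine_kernel_op[OF assms(1-3)])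
  show "op_diff (op_comm (op_A (\<theta> n) a b \<alpha> \<beta> \<omega>) (op_B \<theta>B1 (\<theta>B3 n) a b \<alpha> \<beta> \<omega>)) op_zero x
    = sine_kernel_op a b \<alpha> \<beta> \<omega> (\<lambda>s. - sigma1 a b \<omega> * \<theta> n * \<theta>B3 n * cos (\<omega> * s)) x" for n x
    by (simp add: op_diff_def op_zero_def op_comm_op_A_op_B)
  show "\<bar>- sigma1 a b \<omega> * \<theta> n * \<theta>B3 n * cos (\<omega> * s)\<bar> \<le> \<bar>sigma1 a b \<omega>\<bar> * \<bar>\<theta> n * \<theta>B3 n\<bar>" for n s
    by (auto simp: abs_mult mult.assoc intro!: mult_left_mono mult_left_le)
  show "(\<lambda>n. \<bar>sigma1 a b \<omega>\<bar> * \<bar>\<theta> n * \<theta>B3 n\<bar>) \<longlonglongrightarrow> 0"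
    using tendsto_mult_right_zero[OF tendsto_rabs_zero[OF lim]] .
qed (intro continuous_intros)

end

text \<open>
  Along \<open>Lambda\<close> the orthogonality is part of the constraints, and the bound on the commutator is the
  quantity that tends to zero by hypothesis, times the fixed number \<open>Lp_norm p x\<close>.
\<close>

lemma op_comm_tendsto_within_Lambda:
  assumes p: "1 \<le> p" and x: "x \<in> Lp_space p"
    and lim: "((\<lambda>(\<theta>A1, \<theta>B1, \<theta>B3, \<alpha>\<^sub>1, \<beta>\<^sub>1, \<alpha>, \<beta>, \<sigma>\<^sub>1, \<sigma>\<^sub>2, \<delta>, \<omega>).
          \<theta>B3 * \<theta>A1 * \<sigma>\<^sub>1 * lambda_tilde p \<alpha>\<^sub>1 \<beta>\<^sub>1 \<alpha> \<beta>) \<longlongrightarrow> 0) (at P0 within Lambda)"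
      (is "(?f \<longlongrightarrow> 0) _")
  shows "((\<lambda>(\<theta>A1, \<theta>B1, \<theta>B3, \<alpha>\<^sub>1, \<beta>\<^sub>1, \<alpha>, \<beta>, \<sigma>\<^sub>1, \<sigma>\<^sub>2, \<delta>, \<omega>).
            Lp_norm p (op_comm (op_A \<theta>A1 \<alpha>\<^sub>1 \<beta>\<^sub>1 \<alpha> \<beta> \<omega>) (op_B \<theta>B1 \<theta>B3 \<alpha>\<^sub>1 \<beta>\<^sub>1 \<alpha> \<beta> \<omega>) x)) \<longlongrightarrow> 0)
          (at P0 within Lambda)"
    (is "(?h \<longlongrightarrow> 0) _")
proof (rule tendsto_sandwich[of "\<lambda>_. 0" _ _ "\<lambda>P. ennreal \<bar>?f P\<bar> * Lp_norm p x"])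
  have "?h P \<le> ennreal \<bar>?f P\<bar> * Lp_norm p x" if "P \<in> Lambda" for P
  proof -
    obtain \<theta>A1 \<theta>B1 \<theta>B3 \<alpha>\<^sub>1 \<beta>\<^sub>1 \<alpha> \<beta> \<sigma>\<^sub>1 \<sigma>\<^sub>2 \<delta> \<omega> where
      P: "P = (\<theta>A1, \<theta>B1, \<theta>B3, \<alpha>\<^sub>1, \<beta>\<^sub>1, \<alpha>, \<beta>, \<sigma>\<^sub>1, \<sigma>\<^sub>2, \<delta>, \<omega>)"
      by (metis surj_pair)
    from that have c: "\<alpha>\<^sub>1 < \<beta>\<^sub>1" "\<alpha> \<le> \<alpha>\<^sub>1" "\<beta>\<^sub>1 \<le> \<beta>" "\<sigma>\<^sub>1 = sigma1 \<alpha>\<^sub>1 \<beta>\<^sub>1 \<omega>"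
      and "moment \<alpha>\<^sub>1 \<beta>\<^sub>1 (\<lambda>s. cos (\<omega> * s)) (\<lambda>s. sin (\<omega> * s)) = 0"
      by (auto simp: Lambda_def P sigma1_def moment_def mult.commute)
    then show ?thesis
      using Lp_norm_op_comm_le[of \<alpha> \<alpha>\<^sub>1 \<beta>\<^sub>1 \<beta> \<omega> p x \<theta>A1 \<theta>B1 \<theta>B3] p x by (simp add: P)
  qed
  then show "\<forall>\<^sub>F P in at P0 within Lambda. ?h P \<le> ennreal \<bar>?f P\<bar> * Lp_norm p x"
    by (auto simp: eventually_at_filter)
  have "((\<lambda>P. ennreal \<bar>?f P\<bar>) \<longlongrightarrow> ennreal 0) (at P0 within Lambda)"
    by (intro tendsto_ennrealI tendsto_rabs_zero lim)
  then have "((\<lambda>P. ennreal \<bar>?f P\<bar> * Lp_norm p x) \<longlongrightarrow> ennreal 0 * Lp_norm p x) (at P0 within Lambda)"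
    using x by (intro tendsto_mult_ennreal tendsto_const) (auto simp: Lp_space_def)
  then show "((\<lambda>P. ennreal \<bar>?f P\<bar> * Lp_norm p x) \<longlongrightarrow> 0) (at P0 within Lambda)" by simp
qed auto

theorem theorem2:
  fixes p :: ennreal
    and \<theta>A1 \<theta>B1 \<theta>B3 \<omega> \<delta> \<alpha> \<beta> \<alpha>\<^sub>1 \<beta>\<^sub>1 :: real
    and \<theta> \<zeta> :: "nat \<Rightarrow> real"
    and A B Bt :: operator
    and An Bn :: "nat \<Rightarrow> operator"
  assumes "1 \<le> p"
    and "\<delta> \<noteq> 0"
    and "\<alpha>\<^sub>1 < \<beta>\<^sub>1" and "\<alpha> \<le> \<alpha>\<^sub>1" and "\<beta> \<ge> \<beta>\<^sub>1"
    and "\<omega> / pi * (\<beta>\<^sub>1 - \<alpha>\<^sub>1) \<in> \<int> \<or> \<omega> / pi * (\<beta>\<^sub>1 + \<alpha>\<^sub>1) \<in> \<int>"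
    and "sigma1 \<alpha>\<^sub>1 \<beta>\<^sub>1 \<omega> \<noteq> 0" and "sigma2 \<alpha>\<^sub>1 \<beta>\<^sub>1 \<omega> \<noteq> 0"
    and A_eq: "A = op_A \<theta>A1 \<alpha>\<^sub>1 \<beta>\<^sub>1 \<alpha> \<beta> \<omega>"
    and B_eq: "B = op_B \<theta>B1 \<theta>B3 \<alpha>\<^sub>1 \<beta>\<^sub>1 \<alpha> \<beta> \<omega>"
    and An_eq: "\<And>n. An n = op_A (\<theta> n) \<alpha>\<^sub>1 \<beta>\<^sub>1 \<alpha> \<beta> \<omega>"
    and Bn_eq: "\<And>n. Bn n = op_B \<theta>B1 (\<zeta> n) \<alpha>\<^sub>1 \<beta>\<^sub>1 \<alpha> \<beta> \<omega>"
    and Bt_eq: "Bt = kernel_op \<alpha>\<^sub>1 \<beta>\<^sub>1 \<alpha> \<beta> (\<lambda>t s. \<theta>B1 * sin (\<omega> * t) * cos (\<omega> * s))"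
  shows "
    (Lp_operator p A \<and> Lp_operator p B \<and> Lp_operator p Bt \<and>
      (\<forall>n\<ge>1. Lp_operator p (An n) \<and> Lp_operator p (Bn n))) \<and>
    (Lp_op_eq p (A \<circ> B) (op_scale \<delta> (B \<circ> A ^^ 2)) \<and>
      Lp_op_eq p (op_scale \<delta> (B \<circ> A ^^ 2)) op_zero \<and>
      (\<forall>n\<ge>1.
        Lp_op_eq p (An n \<circ> B) (op_scale \<delta> (B \<circ> An n ^^ 2)) \<and>
        Lp_op_eq p (op_scale \<delta> (B \<circ> An n ^^ 2)) op_zero \<and>
        Lp_op_eq p (A \<circ> Bn n) (op_scale \<delta> (Bn n \<circ> A ^^ 2)) \<and>
        Lp_op_eq p (op_scale \<delta> (Bn n \<circ> A ^^ 2)) op_zero \<and>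
        Lp_op_eq p (An n \<circ> Bn n) (op_scale \<delta> (Bn n \<circ> An n ^^ 2)) \<and>
        Lp_op_eq p (op_scale \<delta> (Bn n \<circ> An n ^^ 2)) op_zero) \<and>
      (\<forall>x\<in>Lp_space p. AE t in lebesgue.
        op_comm A B x t = - (B (A x) t) \<and>
        - (B (A x) t) = - sigma1 \<alpha>\<^sub>1 \<beta>\<^sub>1 \<omega> * \<theta>A1 * \<theta>B3 *
          (LINT s:{\<alpha>\<^sub>1..\<beta>\<^sub>1}|lebesgue.
             indicator {\<alpha>..\<beta>} t * sin (\<omega> * t) * cos (\<omega> * s) * x s))) \<and>
    (\<theta> \<longlonglongrightarrow> 0 \<longrightarrow>
      tendsto_in_norm p An op_zero \<and>
      tendsto_in_norm p (\<lambda>n. op_comm (An n) B) op_zero) \<and>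
    (\<zeta> \<longlonglongrightarrow> 0 \<longrightarrow>
      tendsto_in_norm p Bn Bt \<and>
      tendsto_in_norm p (\<lambda>n. op_comm A (Bn n)) op_zero \<and>
      Lp_op_eq p (Bt \<circ> A) (A \<circ> Bt)) \<and>
    (\<theta> \<longlonglongrightarrow> 0 \<and> \<zeta> \<longlonglongrightarrow> 0 \<longrightarrow>
      tendsto_in_norm p (\<lambda>n. op_comm (An n) (Bn n)) op_zero) \<and>
    (\<forall>P0\<in>closure Lambda.
      ((\<lambda>(\<theta>A1, \<theta>B1, \<theta>B3, \<alpha>\<^sub>1, \<beta>\<^sub>1, \<alpha>, \<beta>, \<sigma>\<^sub>1, \<sigma>\<^sub>2, \<delta>, \<omega>).
          \<theta>B3 * \<theta>A1 * \<sigma>\<^sub>1 * lambda_tilde p \<alpha>\<^sub>1 \<beta>\<^sub>1 \<alpha> \<beta>) \<longlongrightarrow> 0) (at P0 within Lambda) \<longrightarrow>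
      (\<forall>x\<in>Lp_space p.
        ((\<lambda>(\<theta>A1, \<theta>B1, \<theta>B3, \<alpha>\<^sub>1, \<beta>\<^sub>1, \<alpha>, \<beta>, \<sigma>\<^sub>1, \<sigma>\<^sub>2, \<delta>, \<omega>).
            Lp_norm p (op_comm (op_A \<theta>A1 \<alpha>\<^sub>1 \<beta>\<^sub>1 \<alpha> \<beta> \<omega>) (op_B \<theta>B1 \<theta>B3 \<alpha>\<^sub>1 \<beta>\<^sub>1 \<alpha> \<beta> \<omega>) x)) \<longlongrightarrow> 0)
          (at P0 within Lambda)))"
proof -
  note p = \<open>1 \<le> p\<close> and ab = \<open>\<alpha>\<^sub>1 < \<beta>\<^sub>1\<close>
  have window: "\<alpha> \<le> \<alpha>\<^sub>1" "\<beta>\<^sub>1 \<le> \<beta>" and \<alpha>\<beta>: "\<alpha> < \<beta>" using assms(3-5) by auto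
  have orth: "moment \<alpha>\<^sub>1 \<beta>\<^sub>1 (\<lambda>s. cos (\<omega> * s)) (\<lambda>s. sin (\<omega> * s)) = 0"
    using sine_cosine_orthogonal assms(3,6) by simp
  let ?K = "sine_kernel_op \<alpha>\<^sub>1 \<beta>\<^sub>1 \<alpha> \<beta> \<omega>"
  have Bt: "Bt = op_B \<theta>B1 0 \<alpha>\<^sub>1 \<beta>\<^sub>1 \<alpha> \<beta> \<omega>" by (simp add: Bt_eq op_B_def)
  have op_A: "Lp_operator p (op_A c \<alpha>\<^sub>1 \<beta>\<^sub>1 \<alpha> \<beta> \<omega>)" for c
    unfolding op_A_eq
    by (rule Lp_operator_sine_kernel_op[OF p ab \<alpha>\<beta>, where M = "\<bar>c\<bar>"])
      (auto intro!: continuous_intros simp: abs_mult mult_left_le)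
  have op_B: "Lp_operator p (op_B c d \<alpha>\<^sub>1 \<beta>\<^sub>1 \<alpha> \<beta> \<omega>)" for c d
    unfolding op_B_eq
  proof (rule Lp_operator_sine_kernel_op[OF p ab \<alpha>\<beta>, where M = "\<bar>c\<bar> + \<bar>d\<bar>"])
    show "\<bar>c * cos (\<omega> * s) + d * sin (\<omega> * s)\<bar> \<le> \<bar>c\<bar> + \<bar>d\<bar>" for s
      by (rule order_trans[OF abs_triangle_ineq add_mono])
        (auto simp: abs_mult mult_left_le)
  qed (intro continuous_intros)
  note relations = op_A_op_B_relations[OF window orth]
  have commutator: "op_comm A B x t = - (B (A x) t) \<and>
        - (B (A x) t) = - sigma1 \<alpha>\<^sub>1 \<beta>\<^sub>1 \<omega> * \<theta>A1 * \<theta>B3 *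
          (LINT s:{\<alpha>\<^sub>1..\<beta>\<^sub>1}|lebesgue.
             indicator {\<alpha>..\<beta>} t * sin (\<omega> * t) * cos (\<omega> * s) * x s)" for x t
  proof -
    have "(LINT s:{\<alpha>\<^sub>1..\<beta>\<^sub>1}|lebesgue. indicator {\<alpha>..\<beta>} t * sin (\<omega> * t) * cos (\<omega> * s) * x s)
        = ?K (\<lambda>s. cos (\<omega> * s)) x t"
      unfolding kernel_op_separable[symmetric] kernel_op_def by (simp add: mult.assoc)
    moreover have "op_comm A B x t
        = ?K (\<lambda>s. - sigma1 \<alpha>\<^sub>1 \<beta>\<^sub>1 \<omega> * \<theta>A1 * \<theta>B3 * cos (\<omega> * s)) x t"
      by (simp only: A_eq B_eq op_comm_op_A_op_B[OF window orth])
    moreover have "B (A x) t = ?K (\<lambda>s. sigma1 \<alpha>\<^sub>1 \<beta>\<^sub>1 \<omega> * \<theta>A1 * \<theta>B3 * cos (\<omega> * s)) x t"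
      by (simp only: A_eq B_eq op_B_op_A[OF window orth])
    ultimately show ?thesis
      unfolding sine_kernel_op_def moment_scale_left by simp
  qed
  have An_lim: "tendsto_in_norm p An op_zero" if lim: "\<theta> \<longlonglongrightarrow> 0"
  proof (rule tendsto_in_norm_sine_kernel_op[OF p ab \<alpha>\<beta>])
    show "op_diff (An n) op_zero x = ?K (\<lambda>s. \<theta> n * cos (\<omega> * s)) x" for n x
      by (simp add: op_diff_def op_zero_def An_eq op_A_eq)
    show "(\<lambda>n. \<bar>\<theta> n\<bar>) \<longlonglongrightarrow> 0" by (rule tendsto_rabs_zero[OF lim])
  qed (auto intro!: continuous_intros simp: abs_mult mult_left_le)
  have Bn_lim: "tendsto_in_norm p Bn Bt" if lim: "\<zeta> \<longlonglongrightarrow> 0"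
  proof (rule tendsto_in_norm_sine_kernel_op[OF p ab \<alpha>\<beta>])
    show "op_diff (Bn n) Bt x = ?K (\<lambda>s. \<zeta> n * sin (\<omega> * s)) x" if x: "x \<in> Lp_space p" for n x
      unfolding op_diff_def Bn_eq Bt op_B_eq sine_kernel_op_def
        moment_cos_sin[OF Lp_space_set_integrable[OF p ab x]] moment_scale_left
      by (simp add: algebra_simps)
    show "(\<lambda>n. \<bar>\<zeta> n\<bar>) \<longlonglongrightarrow> 0" by (rule tendsto_rabs_zero[OF lim])
  qed (auto intro!: continuous_intros simp: abs_mult mult_left_le)
  note comm_lim = tendsto_in_norm_op_comm[OF window orth p ab \<alpha>\<beta>]
  have An_B: "tendsto_in_norm p (\<lambda>n. op_comm (An n) B) op_zero" if "\<theta> \<longlonglongrightarrow> 0"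
    unfolding An_eq B_eq by (rule comm_lim) (rule tendsto_mult_left_zero[OF that])
  have A_Bn: "tendsto_in_norm p (\<lambda>n. op_comm A (Bn n)) op_zero" if "\<zeta> \<longlonglongrightarrow> 0"
    unfolding A_eq Bn_eq by (rule comm_lim) (rule tendsto_mult_right_zero[OF that])
  have An_Bn: "tendsto_in_norm p (\<lambda>n. op_comm (An n) (Bn n)) op_zero" if "\<theta> \<longlonglongrightarrow> 0" "\<zeta> \<longlonglongrightarrow> 0"
    unfolding An_eq Bn_eq by (rule comm_lim) (rule tendsto_mult_zero[OF that])
  have "Lp_op_eq p (Bt \<circ> A) (A \<circ> Bt)"
    unfolding Lp_op_eq_def A_eq Bt comp_def op_B_op_A[OF window orth]
    by (simp add: op_B_eq op_A_annihilates_range[OF window orth])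
      (simp add: sine_kernel_op_def moment_def)
  then show ?thesis
    using op_A op_B relations commutator An_lim Bn_lim An_B A_Bn An_Bn
      op_comm_tendsto_within_Lambda[OF p]
    unfolding A_eq B_eq An_eq Bn_eq Bt by (intro conjI allI ballI impI AE_I2) blast+
qed

end
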